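(* Let $K$ be a kernel on $\mathbb{R}^m$ satisfying (k1) and (k2), let $h_N>0$ with $\lim_{N\to\infty}h_N=0$, and let $\hat u\in S$ be a fixed optimal solution of $\min_{u\in U}\mathbb{E}[F(u,X)]$. Assume that $F(\hat u,\cdot)$ admits a modulus of continuity of the form $w(t)=\sum_{j=1}^{\ell}L_jt^{\alpha_j}$ with $\ell\ge1$, $L_j\ge0$ and $\alpha_j\in(0,2]$, that is, $|F(\hat u,x+z)-F(\hat u,x)|\le w(\|z\|)$ for all $x,z\in\mathbb{R}^m$. Then there exist constants $L>0$ and $\alpha\in(0,2]$ (independent of $N$) such that the bias of the kernel estimator $\theta_K^{(N)}$ is bounded from above by $Lh_N^\alpha$: $$\mathbb{E}[\theta_K^{(N)}]-\theta\le L\,h_N^{\alpha}.$$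
   Context: $U\subset\mathbb{R}^n$ is nonempty and closed. $X$ is an integrable random vector with values in $\mathbb{R}^m$, and $F:\mathbb{R}^n\times\mathbb{R}^m\to\mathbb{R}$ is sufficiently regular that $\mathbb{E}[F(u,X)]$ is well defined and finite for all $u\in U$. $X_1,X_2,\dots$ are independent random vectors distributed as $X$. Let $\theta=\min_{u\in U}\mathbb{E}[F(u,X)]$, with nonempty set $S$ of optimal solutions, let $\theta_{SAA}^{(N)}=\min_{u\in U}\frac1N\sum_{i=1}^NF(u,X_i)$, and let $$\theta_K^{(N)}=\min_{u\in U}\frac1N\sum_{i=1}^N\int_{\mathbb{R}^m}F(u,x)K\Big(\frac{x-X_i}{h_N}\Big)\frac1{h_N^m}\,dx .$$ The minima are assumed attained and the expectations of these estimators well defined. Standing assumption: the bias $\mathbb{E}[\theta_{SAA}^{(N)}]-\theta$ is strictly negative. (k1): $K$ is a probability density with respect to Lebesgue measure on $\mathbb{R}^m$, symmetric around zero in the sense that $\int_{\mathbb{R}^m}y_lK(y)\,dy=0$ for $l=1,\dots,m$. (k2): $m_2(K)=\int_{\mathbb{R}^m}\|y\|^2K(y)\,dy$ is a finite positive number. *)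

theory Defs
  imports "HOL-Probability.Probability"
begin

(* The infimum is the minimum only when it is attained; attainment is stated
   separately as "opt_solutions U f \<noteq> {}". *)
definition opt_value :: "'a set \<Rightarrow> ('a \<Rightarrow> real) \<Rightarrow> real" where
  "opt_value U f = (INF u\<in>U. f u)"

definition opt_solutions :: "'a set \<Rightarrow> ('a \<Rightarrow> real) \<Rightarrow> 'a set" where
  "opt_solutions U f = {u. is_arg_min f (\<lambda>v. v \<in> U) u}"

definition true_objective ::
  "'w measure \<Rightarrow> ('a \<Rightarrow> 'b \<Rightarrow> real) \<Rightarrow> ('w \<Rightarrow> 'b) \<Rightarrow> 'a \<Rightarrow> real" where
  "true_objective M F X u = (\<integral>\<omega>. F u (X \<omega>) \<partial>M)"

(* Samples are indexed from 1, so N observations are x 1, ..., x N. *)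
definition saa_objective ::
  "('a \<Rightarrow> 'b \<Rightarrow> real) \<Rightarrow> nat \<Rightarrow> (nat \<Rightarrow> 'b) \<Rightarrow> 'a \<Rightarrow> real" where
  "saa_objective F N x u = (1 / real N) * (\<Sum>i=1..N. F u (x i))"

definition kernel_objective ::
  "('a \<Rightarrow> real ^ 'm \<Rightarrow> real) \<Rightarrow> (real ^ 'm \<Rightarrow> real) \<Rightarrow> real \<Rightarrow> nat \<Rightarrow>
   (nat \<Rightarrow> real ^ 'm) \<Rightarrow> 'a \<Rightarrow> real" where
  "kernel_objective F K h N x u =
     (1 / real N) * (\<Sum>i=1..N. \<integral>y. F u y * K ((1 / h) *\<^sub>R (y - x i)) * (1 / h ^ CARD('m)) \<partial>lborel)"

definition theta :: "'w measure \<Rightarrow> 'a set \<Rightarrow> ('a \<Rightarrow> 'b \<Rightarrow> real) \<Rightarrow> ('w \<Rightarrow> 'b) \<Rightarrow> real" where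
  "theta M U F X = opt_value U (true_objective M F X)"

definition theta_SAA ::
  "'a set \<Rightarrow> ('a \<Rightarrow> 'b \<Rightarrow> real) \<Rightarrow> (nat \<Rightarrow> 'w \<Rightarrow> 'b) \<Rightarrow> nat \<Rightarrow> 'w \<Rightarrow> real" where
  "theta_SAA U F Xs N \<omega> = opt_value U (saa_objective F N (\<lambda>i. Xs i \<omega>))"

definition theta_K ::
  "'a set \<Rightarrow> ('a \<Rightarrow> real ^ 'm \<Rightarrow> real) \<Rightarrow> (real ^ 'm \<Rightarrow> real) \<Rightarrow> (nat \<Rightarrow> real) \<Rightarrow>
   (nat \<Rightarrow> 'w \<Rightarrow> real ^ 'm) \<Rightarrow> nat \<Rightarrow> 'w \<Rightarrow> real" where
  "theta_K U F K h Xs N \<omega> = opt_value U (kernel_objective F K (h N) N (\<lambda>i. Xs i \<omega>))"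

definition kernel_k1 :: "(real ^ 'm \<Rightarrow> real) \<Rightarrow> bool" where
  "kernel_k1 K \<longleftrightarrow>
     (\<forall>y. 0 \<le> K y) \<and> has_bochner_integral lborel K 1 \<and>
     (\<forall>l. has_bochner_integral lborel (\<lambda>y. y $ l * K y) 0)"

definition kernel_k2 :: "(real ^ 'm \<Rightarrow> real) \<Rightarrow> bool" where
  "kernel_k2 K \<longleftrightarrow>
     integrable lborel (\<lambda>y. (norm y)\<^sup>2 * K y) \<and> 0 < (\<integral>y. (norm y)\<^sup>2 * K y \<partial>lborel)"

end

theory Submission
  imports Defs
begin

text \<open>
  Evaluating the kernel objective at the fixed optimal solution bounds the random minimum from
  above. After the substitution \<open>y = X\<^sub>i + h z\<close>, the modulus of continuity shows that this value
  exceeds the sample average of \<open>F u_hat\<close>, whose mean is the true optimal value, by at most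
  \<open>\<Sum>j. L\<^sub>j h\<^sup>\<alpha>\<^sup>j \<integral> \<parallel>z\<parallel>\<^sup>\<alpha>\<^sup>j K z dz\<close>. The moments are finite since all exponents are at most 2,
  and as \<open>h\<close> is bounded, the smallest exponent dominates.
\<close>

lemma opt_value_eq:
  assumes "u \<in> opt_solutions U f"
  shows "opt_value U f = f u"
  unfolding opt_value_def
  by (rule cInf_eq_minimum) (use assms in \<open>auto simp: opt_solutions_def is_arg_min_def not_less\<close>)

text \<open>On the reals \<open>INF\<close> is a lower bound only for a family bounded below. An
  attained minimum supplies such a bound, hence the nonemptiness hypothesis.\<close>

lemma opt_value_le:
  assumes "opt_solutions U f \<noteq> {}" "v \<in> U"
  shows "opt_value U f \<le> f v"
proof -
  obtain u where u: "u \<in> opt_solutions U f"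
    using assms(1) by blast
  then show ?thesis
    using assms(2) opt_value_eq[OF u] by (auto simp: opt_solutions_def is_arg_min_def not_less)
qed

text \<open>Lebesgue measure scales by h to the dimension under dilation and is translation
  invariant. Measurability suffices: without integrability both sides take the default value
  0.\<close>

lemma lborel_integral_affine:
  fixes f :: "'a::euclidean_space \<Rightarrow> real"
  assumes [measurable]: "f \<in> borel_measurable borel" and "0 < h"
  shows "(\<integral>y. f y \<partial>lborel) = h ^ DIM('a) * (\<integral>z. f (t + h *\<^sub>R z) \<partial>lborel)"
proof -
  have "(\<integral>y. f y \<partial>lborel) =
      (\<integral>y. f y \<partial>density (distr lborel borel (\<lambda>z. t + h *\<^sub>R z)) (\<lambda>_. ennreal (\<bar>h\<bar> ^ DIM('a))))"
    using \<open>0 < h\<close> by (subst lborel_affine[of h t]) (auto simp: ennreal_power)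
  also have "\<dots> = h ^ DIM('a) * (\<integral>z. f (t + h *\<^sub>R z) \<partial>lborel)"
    using \<open>0 < h\<close> by (simp add: integral_density integral_distr)
  finally show ?thesis .
qed

text \<open>Positive exponents force the modulus to vanish as z tends to 0. The purpose is Borel
  measurability of \<open>F u_hat\<close>, which follows from continuity.\<close>

lemma continuous_powr_modulus:
  fixes f :: "'a::real_normed_vector \<Rightarrow> real"
  assumes "\<And>j. j \<in> J \<Longrightarrow> 0 < \<alpha> j"
    and mod: "\<And>x z. \<bar>f (x + z) - f x\<bar> \<le> (\<Sum>j\<in>J. L j * norm z powr \<alpha> j)"
  shows "continuous_on UNIV f"
proof -
  have "isCont f x" for x
  proof -
    have "((\<lambda>z. \<Sum>j\<in>J. L j * norm z powr \<alpha> j) \<longlongrightarrow> (\<Sum>j\<in>J. L j * norm (0::'a) powr \<alpha> j)) (at 0)"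
      by (intro tendsto_sum tendsto_mult tendsto_const tendsto_powr' tendsto_norm tendsto_ident_at)
         (use assms(1) in \<open>auto intro: tendsto_norm_zero\<close>)
    then have "((\<lambda>z. \<Sum>j\<in>J. L j * norm z powr \<alpha> j) \<longlongrightarrow> 0) (at (0::'a))"
      by simp
    then have "((\<lambda>z. f (x + z) - f x) \<longlongrightarrow> 0) (at 0)"
      by (rule Lim_null_comparison[rotated]) (use mod in auto)
    then show ?thesis
      by (simp add: isCont_iff LIM_zero_iff)
  qed
  then show ?thesis
    by (simp add: continuous_on_eq_continuous_at)
qed

lemma kernel_moment_integrable:
  fixes K :: "real ^ 'm \<Rightarrow> real"
  assumes "kernel_k1 K" "kernel_k2 K" "0 < a" "a \<le> 2"
  shows "integrable lborel (\<lambda>z. norm z powr a * K z)"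
proof (rule Bochner_Integration.integrable_bound)
  have K0: "\<And>z. 0 \<le> K z" and K: "integrable lborel K"
    using assms(1) by (auto simp: kernel_k1_def has_bochner_integral_iff)
  show "integrable lborel (\<lambda>z. K z + (norm z)\<^sup>2 * K z)"
    using K assms(2) by (auto simp: kernel_k2_def)
  show "(\<lambda>z. norm z powr a * K z) \<in> borel_measurable lborel"
    using borel_measurable_integrable[OF K] by measurable
  have "norm z powr a * K z \<le> K z + (norm z)\<^sup>2 * K z" for z
  proof -
    \<comment> \<open>The split at the unit sphere: inside it the power is at most 1, outside it is
      at most the square because \<open>a \<le> 2\<close>.\<close>
    have "norm z powr a \<le> 1 + (norm z)\<^sup>2"
    proof (cases "norm z \<le> 1")
      case True
      then have "norm z powr a \<le> 1" using \<open>0 < a\<close> by (intro powr_le1) auto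
      then show ?thesis by (simp add: add_increasing2)
    next
      case False
      then have "norm z powr a \<le> norm z powr 2" using \<open>a \<le> 2\<close> by (intro powr_mono) auto
      then show ?thesis using False by (simp add: powr_numeral)
    qed
    from mult_right_mono[OF this K0[of z]] show ?thesis
      by (simp add: algebra_simps)
  qed
  then show "AE z in lborel. norm (norm z powr a * K z) \<le> norm (K z + (norm z)\<^sup>2 * K z)"
    using K0 by simp
qed

text \<open>The constant \<open>f x\<close> passes through the smoothing because K has mass 1, so
  only the increment is estimated. The resulting error does not depend on x and therefore survives
  averaging over the sample and taking expectations.\<close>

lemma kernel_smoothing_le:
  fixes K f :: "real ^ 'm \<Rightarrow> real"
  assumes k: "kernel_k1 K" "kernel_k2 K" and "0 < h"
    and J: "\<And>j. j \<in> J \<Longrightarrow> 0 < \<alpha> j \<and> \<alpha> j \<le> 2"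
    and mod: "\<And>x z. \<bar>f (x + z) - f x\<bar> \<le> (\<Sum>j\<in>J. L j * norm z powr \<alpha> j)"
  shows "(\<integral>y. f y * K ((1 / h) *\<^sub>R (y - x)) * (1 / h ^ CARD('m)) \<partial>lborel)
    \<le> f x + (\<Sum>j\<in>J. L j * (\<integral>z. norm z powr \<alpha> j * K z \<partial>lborel) * h powr \<alpha> j)"
proof -
  have K0: "\<And>z. 0 \<le> K z" and K: "integrable lborel K" and K1: "(\<integral>z. K z \<partial>lborel) = 1"
    using k(1) by (auto simp: kernel_k1_def has_bochner_integral_iff)
  have [measurable]: "K \<in> borel_measurable borel"
    using borel_measurable_integrable[OF K] by simp
  have [measurable]: "f \<in> borel_measurable borel"
    using continuous_powr_modulus[of J \<alpha> f L] J mod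
    by (intro borel_measurable_continuous_onI) auto
  \<comment> \<open>The modulus at h z, weighted by K z, with the powers of h pulled out so that
    only moments of K remain under the integral.\<close>
  let ?w = "\<lambda>z::real^'m. \<Sum>j\<in>J. (L j * h powr \<alpha> j) * (norm z powr \<alpha> j * K z)"
  have w: "integrable lborel ?w"
    using kernel_moment_integrable[OF k] J by (intro Bochner_Integration.integrable_sum integrable_mult_right) auto
  have bound: "\<bar>(f (x + h *\<^sub>R z) - f x) * K z\<bar> \<le> ?w z" for z
  proof -
    have "\<bar>f (x + h *\<^sub>R z) - f x\<bar> * K z \<le> (\<Sum>j\<in>J. L j * norm (h *\<^sub>R z) powr \<alpha> j) * K z"
      by (intro mult_right_mono mod K0)
    also have "\<dots> = ?w z"
      using \<open>0 < h\<close> by (simp add: sum_distrib_left powr_mult mult_ac)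
    finally show ?thesis
      using K0 by (simp add: abs_mult)
  qed
  have d: "integrable lborel (\<lambda>z. (f (x + h *\<^sub>R z) - f x) * K z)"
  proof (rule Bochner_Integration.integrable_bound[OF w])
    show "AE z in lborel. norm ((f (x + h *\<^sub>R z) - f x) * K z) \<le> norm (?w z)"
      unfolding real_norm_def by (intro AE_I2 order_trans[OF bound abs_ge_self])
  qed measurable
  \<comment> \<open>The Jacobian of the substitution cancels the normalising factor
    \<open>1 / h ^ CARD('m)\<close>.\<close>
  have "(\<integral>y. f y * K ((1 / h) *\<^sub>R (y - x)) * (1 / h ^ CARD('m)) \<partial>lborel)
      = (\<integral>z. f (x + h *\<^sub>R z) * K z \<partial>lborel)"
    using \<open>0 < h\<close> by (subst lborel_integral_affine[where h = h and t = x]) auto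
  also have "\<dots> = (\<integral>z. f x * K z + (f (x + h *\<^sub>R z) - f x) * K z \<partial>lborel)"
    by (simp add: algebra_simps)
  also have "\<dots> = f x + (\<integral>z. (f (x + h *\<^sub>R z) - f x) * K z \<partial>lborel)"
    using K d K1 by (subst Bochner_Integration.integral_add) auto
  also have "\<dots> \<le> f x + (\<integral>z. ?w z \<partial>lborel)"
    using bound by (intro add_left_mono integral_mono d w) (meson abs_le_D1)
  also have "(\<integral>z. ?w z \<partial>lborel) = (\<Sum>j\<in>J. L j * (\<integral>z. norm z powr \<alpha> j * K z \<partial>lborel) * h powr \<alpha> j)"
    using kernel_moment_integrable[OF k] J
    by (subst Bochner_Integration.integral_sum) (auto intro!: sum.cong)
  finally show ?thesis .
qed

text \<open>Each power splits as \<open>h powr (\<alpha> j - a) * h powr a\<close>; the first factor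
  has a nonnegative exponent, so it is monotone in h and bounded by its value at H. No smallness of
  h is required.\<close>

lemma sum_powr_le_min_powr:
  fixes \<alpha> c :: "'i \<Rightarrow> real"
  assumes "finite J" "\<And>j. j \<in> J \<Longrightarrow> 0 \<le> c j \<and> a \<le> \<alpha> j" "0 < h" "h \<le> H"
  shows "(\<Sum>j\<in>J. c j * h powr \<alpha> j) \<le> (\<Sum>j\<in>J. c j * H powr (\<alpha> j - a)) * h powr a"
  unfolding sum_distrib_right
proof (rule sum_mono)
  fix j assume "j \<in> J"
  then have "c j * (h powr (\<alpha> j - a) * h powr a) \<le> c j * (H powr (\<alpha> j - a) * h powr a)"
    using assms by (intro mult_left_mono mult_right_mono powr_mono2) auto
  then show "c j * h powr \<alpha> j \<le> c j * H powr (\<alpha> j - a) * h powr a"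
    by (simp flip: powr_add add: mult.assoc)
qed

theorem theorem5:
  fixes M :: "'w measure"
    and U :: "(real ^ 'n) set"
    and F :: "real ^ 'n \<Rightarrow> real ^ 'm \<Rightarrow> real"
    and X :: "'w \<Rightarrow> real ^ 'm"
    and Xs :: "nat \<Rightarrow> 'w \<Rightarrow> real ^ 'm"
    and K :: "real ^ 'm \<Rightarrow> real"
    and h :: "nat \<Rightarrow> real"
    and u_hat :: "real ^ 'n"
    and l :: nat
    and Lc \<alpha>c :: "nat \<Rightarrow> real"
  assumes "prob_space M"
    and "U \<noteq> {}" and "closed U"
    and "integrable M X"
    and "\<forall>u\<in>U. integrable M (\<lambda>\<omega>. F u (X \<omega>))"
    and "prob_space.indep_vars M (\<lambda>_. borel) Xs {1..}"
    and "\<forall>i\<ge>1. distr M borel (Xs i) = distr M borel X"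
    and "\<forall>N\<ge>1. AE \<omega> in M. opt_solutions U (saa_objective F N (\<lambda>i. Xs i \<omega>)) \<noteq> {}"
    and "\<forall>N\<ge>1. AE \<omega> in M. opt_solutions U (kernel_objective F K (h N) N (\<lambda>i. Xs i \<omega>)) \<noteq> {}"
    and "\<forall>N\<ge>1. integrable M (theta_SAA U F Xs N)"
    and "\<forall>N\<ge>1. integrable M (theta_K U F K h Xs N)"
    and "\<forall>N\<ge>1. (\<integral>\<omega>. theta_SAA U F Xs N \<omega> \<partial>M) - theta M U F X < 0"
    and "kernel_k1 K" and "kernel_k2 K"
    and "\<forall>N\<ge>1. 0 < h N" and "h \<longlonglongrightarrow> 0"
    and "u_hat \<in> opt_solutions U (true_objective M F X)"
    and "1 \<le> l"
    and "\<forall>j\<in>{1..l}. 0 \<le> Lc j \<and> 0 < \<alpha>c j \<and> \<alpha>c j \<le> 2"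
    and "\<forall>x z. \<bar>F u_hat (x + z) - F u_hat x\<bar> \<le> (\<Sum>j=1..l. Lc j * norm z powr \<alpha>c j)"
  shows "\<exists>L \<alpha>. 0 < L \<and> 0 < \<alpha> \<and> \<alpha> \<le> 2 \<and>
           (\<forall>N\<ge>1. (\<integral>\<omega>. theta_K U F K h Xs N \<omega> \<partial>M) - theta M U F X \<le> L * h N powr \<alpha>)"
proof -
  interpret prob_space M by fact
  let ?f = "F u_hat" and ?J = "{1..l}"
  \<comment> \<open>These coefficients depend only on the modulus and on moments of K, hence not on
    N.\<close>
  define c where "c j = Lc j * (\<integral>z. norm z powr \<alpha>c j * K z \<partial>lborel)" for j
  have K0: "\<And>z. 0 \<le> K z"
    using \<open>kernel_k1 K\<close> by (simp add: kernel_k1_def)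
  have mod: "\<And>x z. \<bar>?f (x + z) - ?f x\<bar> \<le> (\<Sum>j\<in>?J. Lc j * norm z powr \<alpha>c j)"
    using assms(20) by blast
  have J: "\<And>j. j \<in> ?J \<Longrightarrow> 0 \<le> Lc j \<and> 0 < \<alpha>c j \<and> \<alpha>c j \<le> 2"
    using assms(19) by blast
  have c0: "0 \<le> c j" if "j \<in> ?J" for j
    using J[OF that] K0 unfolding c_def by simp
  have uU: "u_hat \<in> U"
    using assms(17) by (simp add: opt_solutions_def is_arg_min_def)
  have theta: "theta M U F X = (\<integral>\<omega>. ?f (X \<omega>) \<partial>M)"
    using opt_value_eq[OF assms(17)] by (simp add: theta_def true_objective_def)
  \<comment> \<open>Integrability of \<open>F u_hat (X \<omega>)\<close> says nothing about
    \<open>?f\<close> off the range of X; measurability of \<open>?f\<close> itself is what lets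
    integrals pass to the law of X.\<close>
  have [measurable]: "?f \<in> borel_measurable borel"
    using continuous_powr_modulus[of ?J \<alpha>c ?f Lc] J mod
    by (intro borel_measurable_continuous_onI) auto
  have [measurable]: "X \<in> borel_measurable M"
    using assms(4) by (rule borel_measurable_integrable)
  have Xs: "integrable M (\<lambda>\<omega>. ?f (Xs i \<omega>)) \<and> (\<integral>\<omega>. ?f (Xs i \<omega>) \<partial>M) = theta M U F X"
    if "1 \<le> i" for i
  proof -
    have [measurable]: "Xs i \<in> borel_measurable M"
      using assms(6) that by (auto simp: indep_vars_def)
    have D: "distr M borel (Xs i) = distr M borel X"
      using assms(7) that by blast
    have "integrable (distr M borel X) ?f"
      using assms(5) uU by (simp add: integrable_distr_eq)
    then have "integrable M (\<lambda>\<omega>. ?f (Xs i \<omega>))"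
      unfolding D[symmetric] by (simp add: integrable_distr_eq)
    moreover have "(\<integral>\<omega>. ?f (Xs i \<omega>) \<partial>M) = (\<integral>x. ?f x \<partial>distr M borel X)"
      unfolding D[symmetric] by (simp add: integral_distr)
    ultimately show ?thesis
      by (simp add: integral_distr theta)
  qed
  have bias: "(\<integral>\<omega>. theta_K U F K h Xs N \<omega> \<partial>M) - theta M U F X \<le> (\<Sum>j\<in>?J. c j * h N powr \<alpha>c j)"
    if N: "1 \<le> N" for N
  proof -
    let ?B = "\<Sum>j\<in>?J. c j * h N powr \<alpha>c j"
    \<comment> \<open>The summand includes \<open>?B\<close>, so \<open>?g\<close> is the sample
      average shifted by \<open>?B\<close> and has mean theta plus \<open>?B\<close>.\<close>
    let ?g = "\<lambda>\<omega>. (1 / real N) * (\<Sum>i=1..N. ?f (Xs i \<omega>) + ?B)"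
    have int: "integrable M ?g"
      using Xs by (intro integrable_mult_right Bochner_Integration.integrable_sum Bochner_Integration.integrable_add) auto
    have le: "kernel_objective F K (h N) N (\<lambda>i. Xs i \<omega>) u_hat \<le> ?g \<omega>" for \<omega>
      unfolding kernel_objective_def c_def using assms(15) N J mod
      by (intro mult_left_mono sum_mono kernel_smoothing_le assms(13,14)) auto
    have "AE \<omega> in M. opt_solutions U (kernel_objective F K (h N) N (\<lambda>i. Xs i \<omega>)) \<noteq> {}"
      using assms(9) N by blast
    \<comment> \<open>The bound \<open>le\<close> holds for every outcome, but the optimal value
      lies below the objective at \<open>u_hat\<close> only where the minimum is attained, that is,
      almost surely.\<close>
    then have "AE \<omega> in M. theta_K U F K h Xs N \<omega> \<le> ?g \<omega>"
      unfolding theta_K_def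
    proof eventually_elim
      case (elim \<omega>)
      show ?case
        using opt_value_le[OF elim uU] le[of \<omega>] by linarith
    qed
    then have "(\<integral>\<omega>. theta_K U F K h Xs N \<omega> \<partial>M) \<le> (\<integral>\<omega>. ?g \<omega> \<partial>M)"
      using assms(11) N int by (intro integral_mono_AE) auto
    also have "(\<integral>\<omega>. ?g \<omega> \<partial>M) = (1 / real N) * (\<Sum>i=1..N. theta M U F X + ?B)"
      using Xs by (simp add: Bochner_Integration.integral_sum Bochner_Integration.integral_add prob_space)
    also have "\<dots> = theta M U F X + ?B"
      using N by simp
    finally show ?thesis by simp
  qed
  define a where "a = Min (\<alpha>c ` ?J)"
  have "a \<in> \<alpha>c ` ?J"
    unfolding a_def using \<open>1 \<le> l\<close> by (intro Min_in) auto
  then have a: "0 < a" "a \<le> 2"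
    using J by auto
  have a_le: "\<And>j. j \<in> ?J \<Longrightarrow> a \<le> \<alpha>c j"
    by (simp add: a_def)
  \<comment> \<open>Convergence of h enters as boundedness, giving one H for all N and so a constant
    independent of N.\<close>
  obtain H where H: "\<And>N. h N \<le> H"
    using convergent_imp_Bseq[OF convergentI[OF assms(16)]] unfolding Bseq_def
    by (metis abs_le_D1 real_norm_def)
  \<comment> \<open>The added 1 keeps L strictly positive even if all \<open>Lc j\<close>
    vanish.\<close>
  define L where "L = (\<Sum>j\<in>?J. c j * H powr (\<alpha>c j - a)) + 1"
  have "0 < L"
    unfolding L_def using c0 by (intro add_nonneg_pos sum_nonneg) auto
  moreover have "(\<integral>\<omega>. theta_K U F K h Xs N \<omega> \<partial>M) - theta M U F X \<le> L * h N powr a"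
    if N: "1 \<le> N" for N
  proof -
    have "(\<Sum>j\<in>?J. c j * h N powr \<alpha>c j) \<le> (\<Sum>j\<in>?J. c j * H powr (\<alpha>c j - a)) * h N powr a"
      using c0 a_le H assms(15) N by (intro sum_powr_le_min_powr) auto
    also have "\<dots> \<le> L * h N powr a"
      by (simp add: L_def algebra_simps)
    finally show ?thesis
      using bias[OF N] by linarith
  qed
  ultimately show ?thesis
    using a by blast
qed

end
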